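(* Let $f\in\mathbb{R}[x]$ be a monic quadratic polynomial without real roots, with non-real roots $re^{\pm i\theta}$, $r>0$, $0<\theta<\pi$, and let $s=\left\lceil \frac{\pi}{\theta}\right\rceil -2$. Let $g_R$ and $g_M^{*}$ be the two monic degree-$s$ polynomials defined in the context. Then for $i=0,\ldots,s$, $$\operatorname{coeff}(g_{R},i)\leq \operatorname{coeff}(g_{M}^{*},i).$$
   Context: $\operatorname{coeff}(g,i)$ denotes the coefficient of $x^i$ in $g$. The polynomial $g_R$ associated with $f=x^2+a_1x+a_0$ is the determinant $g_R=\det M$, where $M=(M_{k,l})_{0\le k,l\le s}$ is the $(s+1)\times(s+1)$ matrix over $\mathbb{R}[x]$ whose last column is $M_{k,s}=x^{k}$ and whose other columns ($0\le l\le s-1$) are given by $M_{l,l}=1$, $M_{l+1,l}=a_1$, $M_{l+2,l}=a_0$ (when $l+2\le s$), and all remaining entries $0$. Its coefficients are $$\operatorname{coeff}(g_{R},i)=\frac{r^{s-i}\sin\big((s-i+1)\theta\big)}{\sin(\theta)},\qquad i=0,\ldots,s.$$ Meissner's monic multiplier is $$g_{M}^{*}=\sum_{i=0}^{s}\frac{r^{s-i}\sin\big((i+1)\theta\big)}{\sin\big((s+1)\theta\big)}\,x^{i}.$$ *)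

theory Defs
  imports Complex_Main "HOL-Computational_Algebra.Polynomial" "Jordan_Normal_Form.Determinant"
begin

text \<open>Rows and columns are indexed by \<open>0, \<dots>, s\<close>.
  For monic quadratic \<open>f\<close>, \<open>coeff f 1\<close> and \<open>coeff f 0\<close> are
  the coefficients \<open>a\<^sub>1\<close> and \<open>a\<^sub>0\<close>, so the columns other than the last
  list the entries \<open>1, a\<^sub>1, a\<^sub>0\<close> downwards from the diagonal.\<close>

definition gR_mat :: "real poly \<Rightarrow> nat \<Rightarrow> real poly mat" where
  "gR_mat f s = mat (s + 1) (s + 1) (\<lambda>(k, l).
     if l = s then monom 1 k
     else if k = l then 1
     else if k = l + 1 then [:coeff f 1:]
     else if k = l + 2 then [:coeff f 0:]
     else 0)"

definition gR :: "real poly \<Rightarrow> nat \<Rightarrow> real poly" where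
  "gR f s = det (gR_mat f s)"

definition gM :: "real \<Rightarrow> real \<Rightarrow> nat \<Rightarrow> real poly" where
  "gM r \<theta> s =
     (\<Sum>i\<le>s. monom (r ^ (s - i) * sin (real (i + 1) * \<theta>) / sin (real (s + 1) * \<theta>)) i)"

end

theory Submission imports Defs begin

text \<open>The recurrence \<open>c\<^sub>k + a\<^sub>1 c\<^sub>k\<^sub>-\<^sub>1 + a\<^sub>0 c\<^sub>k\<^sub>-\<^sub>2 = x\<^sup>k\<close> factors the matrix as a lower unitriangular
  band matrix times the identity with last column replaced by \<open>c\<^sub>0, \<dots>, c\<^sub>s\<close>, so \<open>g\<^sub>R = c\<^sub>s\<close>.
  The comparison of coefficients then reduces to the identity
  \<open>sin ((i+1)\<theta>) sin \<theta> - sin ((s-i+1)\<theta>) sin ((s+1)\<theta>) = - sin ((s+2)\<theta>) sin ((s-i)\<theta>)\<close>,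
  whose right-hand side is nonnegative because \<open>(s+1)\<theta> < \<pi> \<le> (s+2)\<theta>\<close>.\<close>

definition band_mat :: "'a::comm_ring_1 \<Rightarrow> 'a \<Rightarrow> nat \<Rightarrow> 'a mat" where
  "band_mat a b n = mat n n (\<lambda>(k, l).
     if k = l then 1 else if k = l + 1 then a else if k = l + 2 then b else 0)"

definition last_col_mat :: "(nat \<Rightarrow> 'a::comm_ring_1) \<Rightarrow> nat \<Rightarrow> 'a mat" where
  "last_col_mat c s = mat (s + 1) (s + 1) (\<lambda>(k, l).
     if l = s then c k else if k = l then 1 else 0)"

lemma det_band_mat: "det (band_mat a b n) = 1"
proof -
  have "det (band_mat a b n) = prod_list (diag_mat (band_mat a b n))"
    by (rule det_lower_triangular[where n = n]) (auto simp: band_mat_def)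
  also have "diag_mat (band_mat a b n) = replicate n 1"
    by (rule nth_equalityI) (auto simp: diag_mat_def band_mat_def)
  finally show ?thesis
    by simp
qed

lemma det_last_col_mat: "det (last_col_mat c s) = c s"
proof -
  have "det (last_col_mat c s) = prod_list (diag_mat (last_col_mat c s))"
    by (rule det_upper_triangular[where n = "s + 1"])
      (auto simp: last_col_mat_def upper_triangular_def)
  also have "diag_mat (last_col_mat c s) = replicate s 1 @ [c s]"
    by (rule nth_equalityI)
      (auto simp: diag_mat_def last_col_mat_def nth_append less_Suc_eq simp del: upt_Suc)
  finally show ?thesis
    by simp
qed

text \<open>Each offset 0, 1, 2 selects at most one index \<open>j\<close>, and \<open>k < n\<close>
  keeps it in range. The guards encode c_(-1) = c_(-2) = 0, where truncated subtraction would
  wrongly yield \<open>c 0\<close>.\<close>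

lemma band_mat_row_sum:
  fixes a b :: "'a::comm_ring_1" and k n :: nat
  assumes "k < n"
  shows "(\<Sum>j<n. (if k = j then 1 else if k = j + 1 then a else if k = j + 2 then b else 0) * c j)
    = c k + (if k \<ge> 1 then a * c (k - 1) else 0) + (if k \<ge> 2 then b * c (k - 2) else 0)"
proof -
  have "(\<Sum>j<n. (if k = j then 1 else if k = j + 1 then a else if k = j + 2 then b else 0) * c j)
      = (\<Sum>j<n. (if j = k then c j else 0) + (if k = j + 1 then a * c j else 0)
          + (if k = j + 2 then b * c j else 0))"
    by (intro sum.cong refl) simp
  also have "\<dots> = (\<Sum>j<n. if j = k then c j else 0) + (\<Sum>j<n. if k = j + 1 then a * c j else 0)
      + (\<Sum>j<n. if k = j + 2 then b * c j else 0)"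
    by (simp only: sum.distrib)
  also have "(\<Sum>j<n. if j = k then c j else 0) = c k"
    using assms by simp
  also have "(\<Sum>j<n. if k = j + 1 then a * c j else 0) = (if k \<ge> 1 then a * c (k - 1) else 0)"
  proof (cases k)
    case (Suc m)
    then have "(\<Sum>j<n. if k = j + 1 then a * c j else 0) = (\<Sum>j<n. if j = m then a * c j else 0)"
      by (intro sum.cong refl) auto
    then show ?thesis
      using assms Suc by simp
  qed simp
  also have "(\<Sum>j<n. if k = j + 2 then b * c j else 0) = (if k \<ge> 2 then b * c (k - 2) else 0)"
  proof (cases "k \<ge> 2")
    case True
    then have "(\<Sum>j<n. if k = j + 2 then b * c j else 0) = (\<Sum>j<n. if j = k - 2 then b * c j else 0)"
      by (intro sum.cong refl) auto
    then show ?thesis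
      using assms True by simp
  qed simp
  finally show ?thesis .
qed

text \<open>Turns the evaluation of the determinant into exhibiting one sequence of polynomials that
  solves the recurrence.\<close>

lemma gR_eqI:
  assumes rec: "\<And>k. c k + (if k \<ge> 1 then [:coeff f 1:] * c (k - 1) else 0)
      + (if k \<ge> 2 then [:coeff f 0:] * c (k - 2) else 0) = monom 1 k"
  shows "gR f s = c s"
proof -
  let ?B = "band_mat [:coeff f 1:] [:coeff f 0:] (s + 1)"
  let ?C = "last_col_mat c s"
  have "gR_mat f s = ?B * ?C"
  proof (rule eq_matI)
    fix k l assume "k < dim_row (?B * ?C)" "l < dim_col (?B * ?C)"
    then have kl: "k < s + 1" "l < s + 1"
      by (auto simp: band_mat_def last_col_mat_def)
    have entry: "(?B * ?C) $$ (k, l) = (\<Sum>j<s+1.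
        (if k = j then 1 else if k = j + 1 then [:coeff f 1:] else if k = j + 2 then [:coeff f 0:] else 0)
        * (if l = s then c j else if j = l then 1 else 0))"
      using kl by (auto simp: band_mat_def last_col_mat_def scalar_prod_def atLeast0LessThan
          intro!: sum.cong)
    show "gR_mat f s $$ (k, l) = (?B * ?C) $$ (k, l)"
    \<comment> \<open>The last column of the product is the left-hand side of the recurrence. Any
      other column of \<open>?C\<close> is a unit vector, so it copies column \<open>l\<close> of
      \<open>?B\<close>.\<close>
    proof (cases "l = s")
      case True
      then have "(?B * ?C) $$ (k, l) = monom 1 k"
        unfolding entry using band_mat_row_sum[OF kl(1), of "[:coeff f 1:]" "[:coeff f 0:]" c] rec[of k]
        by simp
      then show ?thesis
        using True kl by (simp add: gR_mat_def)
    next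
      case False
      then have "(?B * ?C) $$ (k, l)
          = (if k = l then 1 else if k = l + 1 then [:coeff f 1:] else if k = l + 2 then [:coeff f 0:] else 0)"
        unfolding entry using kl by (simp add: if_distrib[of "(*) _"] sum.delta cong: if_cong)
      then show ?thesis
        using False kl by (simp add: gR_mat_def)
    qed
  qed (auto simp: gR_mat_def band_mat_def last_col_mat_def)
  then have "gR f s = det ?B * det ?C"
    unfolding gR_def
    by (simp add: det_mult[of _ "s + 1"] band_mat_def last_col_mat_def)
  then show ?thesis
    by (simp add: det_band_mat det_last_col_mat)
qed

text \<open>Adding the expansions of sin(\<alpha> + \<theta>) and sin(\<alpha> - \<theta>) for
  \<alpha> = (m+1)\<theta> cancels the cosine terms. This is the Chebyshev recurrence behind
  \<open>U2\<close> below.\<close>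

lemma sin_add_two:
  fixes \<theta> :: real
  shows "sin (real (m + 2) * \<theta>) = 2 * cos \<theta> * sin (real (m + 1) * \<theta>) - sin (real m * \<theta>)"
proof -
  have "sin (real (m + 1) * \<theta> + \<theta>) + sin (real (m + 1) * \<theta> - \<theta>) = 2 * cos \<theta> * sin (real (m + 1) * \<theta>)"
    by (simp add: sin_add sin_diff)
  then show ?thesis
    by (simp add: algebra_simps)
qed

text \<open>Generating functions suggest the witnesses: \<open>U m\<close> is the coefficient of t^m
  in 1/(1 + a1 t + a0 t^2), and \<open>c k\<close> that of t^k in 1/((1 - x t)(1 + a1 t + a0 t^2)).
  Multiplying the latter by the quadratic leaves 1/(1 - x t), whose coefficients are x^k.\<close>

lemma coeff_gR:
  assumes a1: "coeff f 1 = - 2 * r * cos \<theta>" and a0: "coeff f 0 = r\<^sup>2" and "sin \<theta> \<noteq> 0" and "i \<le> s"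
  shows "coeff (gR f s) i = r ^ (s - i) * sin (real (s - i + 1) * \<theta>) / sin \<theta>"
proof -
  define U where "U m = r ^ m * sin (real (m + 1) * \<theta>) / sin \<theta>" for m
  define c where "c k = (\<Sum>j\<le>k. monom (U (k - j)) j)" for k
  have U0: "U 0 = 1"
    using assms by (simp add: U_def)
  have U1: "U (Suc 0) = 2 * r * cos \<theta>"
    using assms sin_add_two[of 0 \<theta>] by (simp add: U_def field_simps)
  have U2: "U (Suc (Suc m)) = 2 * r * cos \<theta> * U (Suc m) - r\<^sup>2 * U m" for m
  proof -
    have "sin (real (Suc (Suc m) + 1) * \<theta>)
        = 2 * cos \<theta> * sin (real (Suc m + 1) * \<theta>) - sin (real (m + 1) * \<theta>)"
      using sin_add_two[of "m + 1" \<theta>] by simp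
    then show ?thesis
      unfolding U_def by (simp only:) (simp add: algebra_simps diff_divide_distrib power2_eq_square)
  qed
  have coeff_c: "coeff (c k) j = (if j \<le> k then U (k - j) else 0)" for k j
    by (simp add: c_def coeff_sum sum.delta)
  have "gR f s = c s"
  proof (rule gR_eqI, rule poly_eqI)
    fix k n :: nat
    \<comment> \<open>At x^n the recurrence involves \<open>U\<close> at k-n, k-n-1 and k-n-2. The
      four cases are: no term present, \<open>U0\<close> alone, \<open>U1\<close> against
      \<open>U0\<close>, and the full three-term relation \<open>U2\<close>.\<close>
    have "n > k \<or> n = k \<or> k = n + 1 \<or> k = n + (k - n - 2) + 2"
      by linarith
    then consider "n > k" | "n = k" | "k = n + 1" | m where "k = n + m + 2"
      by blast
    then show "coeff (c k + (if k \<ge> 1 then [:coeff f 1:] * c (k - 1) else 0)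
        + (if k \<ge> 2 then [:coeff f 0:] * c (k - 2) else 0)) n = coeff (monom 1 k) n"
    proof cases
      case 4
      then have "k - n = Suc (Suc m)" "k - 1 - n = Suc m" "k - 2 - n = m"
        by auto
      with 4 show ?thesis
        by (auto simp: coeff_c U2 a0 a1[unfolded One_nat_def])
    qed (auto simp: coeff_c U0 U1 a0 a1[unfolded One_nat_def])
  qed
  then show ?thesis
    using \<open>i \<le> s\<close> by (simp add: coeff_c U_def)
qed

lemma coeff_gM:
  "i \<le> s \<Longrightarrow> coeff (gM r \<theta> s) i = r ^ (s - i) * sin (real (i + 1) * \<theta>) / sin (real (s + 1) * \<theta>)"
  by (simp add: gM_def coeff_sum sum.delta)

text \<open>The imaginary part of f(r e^(i\<theta>)) = 0 factors as r sin \<theta> (a1 + 2 r cos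
  \<theta>), which determines a1 because r sin \<theta> is nonzero; the real part then determines
  a0.\<close>

lemma quadratic_coeffs_of_root:
  fixes f :: "real poly"
  assumes "degree f = 2" "lead_coeff f = 1" "r > 0" "sin \<theta> \<noteq> 0"
    and root: "poly (map_poly complex_of_real f) (rcis r \<theta>) = 0"
  shows "coeff f 1 = - 2 * r * cos \<theta>" "coeff f 0 = r\<^sup>2"
proof -
  have "f = [:coeff f 0, coeff f 1, 1:]"
  proof (rule poly_eqI)
    fix n
    have "coeff f n = 0" if "n > 2"
      using that assms(1) by (simp add: coeff_eq_0)
    moreover have "coeff f 2 = 1"
      using assms by simp
    ultimately show "coeff f n = coeff [:coeff f 0, coeff f 1, 1:] n"
      by (cases "n > 2") (auto simp: coeff_pCons numeral_2_eq_2 not_less le_Suc_eq split: nat.split)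
  qed
  then have "map_poly complex_of_real f = map_poly complex_of_real [:coeff f 0, coeff f 1, 1:]"
    by (rule arg_cong)
  also have "\<dots> = [:complex_of_real (coeff f 0), complex_of_real (coeff f 1), 1:]"
    by (simp add: map_poly_pCons)
  finally have eq: "complex_of_real (coeff f 0) + rcis r \<theta> * (complex_of_real (coeff f 1) + rcis r \<theta>) = 0"
    using root by simp
  have "r * sin \<theta> * (coeff f 1 + 2 * r * cos \<theta>) = 0"
    using arg_cong[OF eq, of Im] by (simp add: algebra_simps)
  then show a1: "coeff f 1 = - 2 * r * cos \<theta>"
    using assms by (simp add: eq_neg_iff_add_eq_0)
  have "coeff f 0 = r\<^sup>2 * (sin \<theta>)\<^sup>2 + r\<^sup>2 * (cos \<theta>)\<^sup>2"
    using arg_cong[OF eq, of Re] a1 by (simp add: algebra_simps power2_eq_square)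
  then show "coeff f 0 = r\<^sup>2"
    by (simp add: distrib_left[symmetric])
qed

text \<open>By product-to-sum, with x = i\<theta> and y = (s-i)\<theta>, both products on the left
  contribute cos x / 2, which cancels. What remains is half of cos(x + 2y + 2\<theta>) - cos(x +
  2\<theta>), the expansion of the right-hand side.\<close>

lemma sin_prod_diff:
  fixes \<theta> :: real
  assumes "i \<le> s"
  shows "sin (real (i + 1) * \<theta>) * sin \<theta> - sin (real (s - i + 1) * \<theta>) * sin (real (s + 1) * \<theta>)
    = - sin (real (s + 2) * \<theta>) * sin (real (s - i) * \<theta>)"
proof -
  obtain d where d: "s = i + d"
    using assms le_Suc_ex by blast
  define x y where "x = real i * \<theta>" and "y = real d * \<theta>"
  have args: "real (i + 1) * \<theta> = x + \<theta>" "real (s - i + 1) * \<theta> = y + \<theta>"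
    "real (s + 1) * \<theta> = x + y + \<theta>" "real (s + 2) * \<theta> = x + y + 2 * \<theta>" "real (s - i) * \<theta> = y"
    by (simp_all add: d x_def y_def algebra_simps)
  have "x + \<theta> - \<theta> = x" "x + \<theta> + \<theta> = x + 2 * \<theta>"
    "y + \<theta> - (x + y + \<theta>) = - x" "y + \<theta> + (x + y + \<theta>) = x + 2 * y + 2 * \<theta>"
    "x + y + 2 * \<theta> - y = x + 2 * \<theta>" "x + y + 2 * \<theta> + y = x + 2 * y + 2 * \<theta>"
    by simp_all
  then show ?thesis
    unfolding args by (simp add: sin_times_sin minus_mult_left[symmetric] diff_divide_distrib add_ac)
qed

text \<open>Here s + 2 is the ceiling of pi/\<theta>, so s + 1 < pi/\<theta> \<le> s + 2, strict
  only on the left. The equation for \<open>s\<close> is over the integers, so its subtraction is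
  not truncated.\<close>

lemma ceiling_angle_bounds:
  assumes "0 < \<theta>" and "int s = \<lceil>pi / \<theta>\<rceil> - 2"
  shows "real (s + 1) * \<theta> < pi" "pi \<le> real (s + 2) * \<theta>"
proof -
  have "real s + 2 = of_int \<lceil>pi / \<theta>\<rceil>"
    using assms(2) by linarith
  then have "real s + 1 < pi / \<theta>" "pi / \<theta> \<le> real s + 2"
    by linarith+
  then show "real (s + 1) * \<theta> < pi" "pi \<le> real (s + 2) * \<theta>"
    using assms(1) by (simp_all add: field_simps)
qed

theorem lemma19:
  fixes f :: "real poly" and r \<theta> :: real and s :: nat
  assumes "degree f = 2" and "lead_coeff f = 1"
    and "\<forall>x::real. poly f x \<noteq> 0"
    and "r > 0" and "0 < \<theta>" and "\<theta> < pi"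
    and "{z. poly (map_poly complex_of_real f) z = 0} = {rcis r \<theta>, rcis r (- \<theta>)}"
    and "int s = \<lceil>pi / \<theta>\<rceil> - 2"
  shows "\<forall>i\<le>s. coeff (gR f s) i \<le> coeff (gM r \<theta> s) i"
proof (intro allI impI)
  fix i assume i: "i \<le> s"
  have sin_pos: "sin \<theta> > 0"
    using assms by (simp add: sin_gt_zero)
  have root: "poly (map_poly complex_of_real f) (rcis r \<theta>) = 0"
    using assms(7) by blast
  note bounds = ceiling_angle_bounds[OF assms(5,8)]
  note a = quadratic_coeffs_of_root[OF assms(1,2,4) _ root]
  have pos: "sin (real (s + 1) * \<theta>) > 0"
    using bounds(1) assms(5) by (intro sin_gt_zero) auto
  \<comment> \<open>The upper bound (s+2)\<theta> < 2 pi comes from adding (s+1)\<theta> < pi and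
    \<theta> < pi.\<close>
  have "sin (real (s + 2) * \<theta>) \<le> 0"
    using bounds assms(5,6) by (intro sin_le_zero) (auto simp: algebra_simps)
  \<comment> \<open>This places (s-i)\<theta> in [0, pi), where the sine is nonnegative.\<close>
  moreover have "real (s - i) * \<theta> \<le> real (s + 1) * \<theta>"
    using assms(5) by (intro mult_right_mono) auto
  then have "sin (real (s - i) * \<theta>) \<ge> 0"
    using bounds(1) assms(5) by (intro sin_ge_zero) (simp, linarith)
  ultimately have "sin (real (s - i + 1) * \<theta>) * sin (real (s + 1) * \<theta>) \<le> sin (real (i + 1) * \<theta>) * sin \<theta>"
    using sin_prod_diff[OF i, of \<theta>] mult_nonpos_nonneg[of "sin (real (s + 2) * \<theta>)" "sin (real (s - i) * \<theta>)"]
    by linarith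
  then have "sin (real (s - i + 1) * \<theta>) / sin \<theta> \<le> sin (real (i + 1) * \<theta>) / sin (real (s + 1) * \<theta>)"
    using sin_pos pos by (simp add: pos_divide_le_eq pos_le_divide_eq)
  then have "r ^ (s - i) * (sin (real (s - i + 1) * \<theta>) / sin \<theta>)
      \<le> r ^ (s - i) * (sin (real (i + 1) * \<theta>) / sin (real (s + 1) * \<theta>))"
    using assms(4) by (intro mult_left_mono) auto
  then show "coeff (gR f s) i \<le> coeff (gM r \<theta> s) i"
    using a sin_pos i by (simp add: coeff_gR coeff_gM)
qed

end
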